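(* Let $\mathcal{X}$ be a Hilbert module over a pro-$C^*$-algebra $\mathcal{A}$, let $K\in Hom^*_{\mathcal{A}}(\mathcal{X})$, and let $\{\xi_i\}_{i\in I}$ and $\{\eta_i\}_{i\in I}$ be Parseval $K$-frames for $\mathcal{X}$ with synthesis operators $L_1,L_2:\mathcal{H}_{\mathcal{A}}\to\mathcal{X}$ (so $L_1e_i=\xi_i$, $L_2e_i=\eta_i$ for the standard orthonormal basis $\{e_i\}$ of $\mathcal{H}_{\mathcal{A}}$). If $L_1L_2^*=0$, then $\{\xi_i+\eta_i\}_{i\in I}$ is a $2$-tight $K$-frame for $\mathcal{X}$, i.e. $\sum_{i\in I}\langle\xi,\xi_i+\eta_i\rangle\langle\xi_i+\eta_i,\xi\rangle=2\langle K^*\xi,K^*\xi\rangle$ for all $\xi\in\mathcal{X}$.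
   Context: A pro-$C^*$-algebra $\mathcal{A}$ is a complete Hausdorff topological $*$-algebra whose topology is given by its continuous $C^*$-seminorms. A Hilbert $\mathcal{A}$-module $\mathcal{X}$ is a left $\mathcal{A}$-module with a complete $\mathcal{A}$-valued inner product. $Hom^*_{\mathcal{A}}(\mathcal{X})$ denotes adjointable bounded $\mathcal{A}$-module maps. $\mathcal{H}_{\mathcal{A}}$ is the Hilbert $\mathcal{A}$-module of sequences $(a_i)$ in $\mathcal{A}$ with $\sum_i a_i^*a_i$ convergent, inner product $\langle (a_i),(b_i)\rangle=\sum_ia_ib_i^*$; $e_i$ has $1_{\mathcal{A}}$ in position $i$, $0$ elsewhere; the synthesis operator of $\{\xi_i\}$ is $(c_i)\mapsto\sum_ic_i\xi_i$. A sequence $\{\xi_i\}_{i\in I}$ ($I$ countable) is a Parseval $K$-frame if $\sum_i\langle\xi,\xi_i\rangle\langle\xi_i,\xi\rangle=\langle K^*\xi,K^*\xi\rangle$ for all $\xi\in\mathcal{X}$ (series convergent in $\mathcal{A}$); it is $A$-tight if $\sum_i\langle\xi,\xi_i\rangle\langle\xi_i,\xi\rangle=A\langle K^*\xi,K^*\xi\rangle$ for all $\xi$.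
   Formalization: $\mathcal{H}_{\mathcal{A}}$ is taken as the sequences with $\sum_i a_ia_i^*$ convergent, not $\sum_i a_i^*a_i$, since otherwise the inner product $\sum_i a_ib_i^*$ need not converge for noncommutative $\mathcal{A}$. *)

theory Defs
  imports "HOL-Analysis.Analysis"
begin

definition sn_has_sum :: "('b::ab_group_add \<Rightarrow> real) set \<Rightarrow> ('i \<Rightarrow> 'b) \<Rightarrow> 'i set \<Rightarrow> 'b \<Rightarrow> bool" where
  "sn_has_sum N f I s \<longleftrightarrow>
     (\<forall>p\<in>N. \<forall>\<epsilon>>0. eventually (\<lambda>F. p (sum f F - s) < \<epsilon>) (finite_subsets_at_top I))"

definition sn_complete :: "('b::ab_group_add \<Rightarrow> real) set \<Rightarrow> bool" where
  "sn_complete N \<longleftrightarrow>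
     (\<forall>F. F \<noteq> bot \<and> (\<forall>p\<in>N. \<forall>\<epsilon>>0. eventually (\<lambda>(x, y). p (x - y) < \<epsilon>) (F \<times>\<^sub>F F))
        \<longrightarrow> (\<exists>s. \<forall>p\<in>N. \<forall>\<epsilon>>0. eventually (\<lambda>x. p (x - s) < \<epsilon>) F))"

definition sn_hausdorff :: "('b::ab_group_add \<Rightarrow> real) set \<Rightarrow> bool" where
  "sn_hausdorff N \<longleftrightarrow> (\<forall>a. a \<noteq> 0 \<longrightarrow> (\<exists>p\<in>N. p a \<noteq> 0))"

text \<open>Continuity (at 0, equivalently everywhere) of a seminorm q w.r.t. the topology of N.\<close>
definition sn_continuous :: "('b::ab_group_add \<Rightarrow> real) set \<Rightarrow> ('b \<Rightarrow> real) \<Rightarrow> bool" where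
  "sn_continuous N q \<longleftrightarrow>
     (\<forall>\<epsilon>>0. \<exists>F \<delta>. finite F \<and> F \<subseteq> N \<and> \<delta> > 0 \<and> (\<forall>a. (\<forall>p\<in>F. p a < \<delta>) \<longrightarrow> q a < \<epsilon>))"

definition star_algebra :: "('a::ring_1 \<Rightarrow> 'a) \<Rightarrow> (complex \<Rightarrow> 'a \<Rightarrow> 'a) \<Rightarrow> bool" where
  "star_algebra st sc \<longleftrightarrow>
     (\<forall>a. sc 1 a = a) \<and>
     (\<forall>c d a. sc (c * d) a = sc c (sc d a)) \<and>
     (\<forall>c d a. sc (c + d) a = sc c a + sc d a) \<and>
     (\<forall>c a b. sc c (a + b) = sc c a + sc c b) \<and>
     (\<forall>c a b. sc c (a * b) = sc c a * b) \<and>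
     (\<forall>c a b. sc c (a * b) = a * sc c b) \<and>
     (\<forall>a. st (st a) = a) \<and>
     (\<forall>a b. st (a + b) = st a + st b) \<and>
     (\<forall>a b. st (a * b) = st b * st a) \<and>
     (\<forall>c a. st (sc c a) = sc (cnj c) (st a))"

definition c_star_seminorm :: "('a::ring_1 \<Rightarrow> 'a) \<Rightarrow> (complex \<Rightarrow> 'a \<Rightarrow> 'a) \<Rightarrow> ('a \<Rightarrow> real) \<Rightarrow> bool" where
  "c_star_seminorm st sc p \<longleftrightarrow>
     (\<forall>a. 0 \<le> p a) \<and>
     (\<forall>a b. p (a + b) \<le> p a + p b) \<and>
     (\<forall>c a. p (sc c a) = cmod c * p a) \<and>
     (\<forall>a b. p (a * b) \<le> p a * p b) \<and>
     (\<forall>a. p (st a * a) = (p a)\<^sup>2)"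

text \<open>A pro-C*-algebra: a complete Hausdorff topological *-algebra whose topology is the one
  generated by the family S of its continuous C*-seminorms (S consists of C*-seminorms and
  contains every C*-seminorm that is continuous for the topology generated by S).\<close>
definition pro_C_star_algebra ::
  "('a::ring_1 \<Rightarrow> 'a) \<Rightarrow> (complex \<Rightarrow> 'a \<Rightarrow> 'a) \<Rightarrow> ('a \<Rightarrow> real) set \<Rightarrow> bool" where
  "pro_C_star_algebra st sc S \<longleftrightarrow>
     star_algebra st sc \<and>
     (\<forall>p\<in>S. c_star_seminorm st sc p) \<and>
     (\<forall>q. c_star_seminorm st sc q \<and> sn_continuous S q \<longrightarrow> q \<in> S) \<and>
     sn_hausdorff S \<and> sn_complete S"

definition positive_elem :: "('a::ring_1 \<Rightarrow> 'a) \<Rightarrow> 'a \<Rightarrow> bool" where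
  "positive_elem st a \<longleftrightarrow> (\<exists>b. a = st b * b)"

definition mod_seminorms :: "('a::ring_1 \<Rightarrow> real) set \<Rightarrow> ('x \<Rightarrow> 'x \<Rightarrow> 'a) \<Rightarrow> ('x \<Rightarrow> real) set" where
  "mod_seminorms S ip = (\<lambda>p \<xi>. sqrt (p (ip \<xi> \<xi>))) ` S"

text \<open>Left A-module with A-valued inner product, A-linear in the first argument; complex
  scalars act on the module through the unital action (c\<cdot>xi = (c 1) xi).\<close>
definition hilbert_module ::
  "('a::ring_1 \<Rightarrow> 'a) \<Rightarrow> (complex \<Rightarrow> 'a \<Rightarrow> 'a) \<Rightarrow> ('a \<Rightarrow> real) set \<Rightarrow>
   ('a \<Rightarrow> 'x::ab_group_add \<Rightarrow> 'x) \<Rightarrow> ('x \<Rightarrow> 'x \<Rightarrow> 'a) \<Rightarrow> bool" where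
  "hilbert_module st sc S act ip \<longleftrightarrow>
     (\<forall>a b x. act (a + b) x = act a x + act b x) \<and>
     (\<forall>a x y. act a (x + y) = act a x + act a y) \<and>
     (\<forall>a b x. act (a * b) x = act a (act b x)) \<and>
     (\<forall>x. act 1 x = x) \<and>
     (\<forall>x y z. ip (x + y) z = ip x z + ip y z) \<and>
     (\<forall>a x y. ip (act a x) y = a * ip x y) \<and>
     (\<forall>x y. st (ip x y) = ip y x) \<and>
     (\<forall>x. positive_elem st (ip x x)) \<and>
     (\<forall>x. ip x x = 0 \<longrightarrow> x = 0) \<and>
     sn_complete (mod_seminorms S ip)"

definition is_adjoint :: "('x \<Rightarrow> 'x \<Rightarrow> 'a) \<Rightarrow> ('x \<Rightarrow> 'x) \<Rightarrow> ('x \<Rightarrow> 'x) \<Rightarrow> bool" where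
  "is_adjoint ip T Ts \<longleftrightarrow> (\<forall>x y. ip (T x) y = ip x (Ts y))"

definition hom_star ::
  "('a::ring_1 \<Rightarrow> real) set \<Rightarrow> ('a \<Rightarrow> 'x::ab_group_add \<Rightarrow> 'x) \<Rightarrow> ('x \<Rightarrow> 'x \<Rightarrow> 'a) \<Rightarrow> ('x \<Rightarrow> 'x) \<Rightarrow> bool" where
  "hom_star S act ip T \<longleftrightarrow>
     (\<forall>a x y. T (act a x + y) = act a (T x) + T y) \<and>
     (\<forall>p\<in>S. \<exists>C. \<forall>x. sqrt (p (ip (T x) (T x))) \<le> C * sqrt (p (ip x x))) \<and>
     (\<exists>Ts. is_adjoint ip T Ts)"

definition in_HA :: "('a::ring_1 \<Rightarrow> 'a) \<Rightarrow> ('a \<Rightarrow> real) set \<Rightarrow> ('i \<Rightarrow> 'a) \<Rightarrow> bool" where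
  "in_HA st S c \<longleftrightarrow> (\<exists>s. sn_has_sum S (\<lambda>i. c i * st (c i)) UNIV s)"

definition synthesis_op ::
  "('a::ring_1 \<Rightarrow> 'a) \<Rightarrow> ('a \<Rightarrow> real) set \<Rightarrow> ('a \<Rightarrow> 'x::ab_group_add \<Rightarrow> 'x) \<Rightarrow> ('x \<Rightarrow> 'x \<Rightarrow> 'a) \<Rightarrow>
   ('i \<Rightarrow> 'x) \<Rightarrow> (('i \<Rightarrow> 'a) \<Rightarrow> 'x) \<Rightarrow> bool" where
  "synthesis_op st S act ip \<xi>s L \<longleftrightarrow>
     (\<forall>c. in_HA st S c \<longrightarrow> sn_has_sum (mod_seminorms S ip) (\<lambda>i. act (c i) (\<xi>s i)) UNIV (L c))"

text \<open>Ls : X \<rightarrow> H_A is the adjoint of L : H_A \<rightarrow> X, where the H_A inner product is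
  sum_i c_i d_i^*.\<close>
definition HA_adjoint ::
  "('a::ring_1 \<Rightarrow> 'a) \<Rightarrow> ('a \<Rightarrow> real) set \<Rightarrow> ('x \<Rightarrow> 'x \<Rightarrow> 'a) \<Rightarrow>
   (('i \<Rightarrow> 'a) \<Rightarrow> 'x) \<Rightarrow> ('x \<Rightarrow> 'i \<Rightarrow> 'a) \<Rightarrow> bool" where
  "HA_adjoint st S ip L Ls \<longleftrightarrow>
     (\<forall>x. in_HA st S (Ls x) \<and>
          (\<forall>c. in_HA st S c \<longrightarrow> sn_has_sum S (\<lambda>i. c i * st (Ls x i)) UNIV (ip (L c) x)))"

definition parseval_K_frame ::
  "('a::ring_1 \<Rightarrow> real) set \<Rightarrow> ('x \<Rightarrow> 'x \<Rightarrow> 'a) \<Rightarrow> ('x \<Rightarrow> 'x) \<Rightarrow> ('i \<Rightarrow> 'x) \<Rightarrow> bool" where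
  "parseval_K_frame S ip Ks \<xi>s \<longleftrightarrow>
     (\<forall>x. sn_has_sum S (\<lambda>i. ip x (\<xi>s i) * ip (\<xi>s i) x) UNIV (ip (Ks x) (Ks x)))"

definition tight_K_frame ::
  "(complex \<Rightarrow> 'a::ring_1 \<Rightarrow> 'a) \<Rightarrow> ('a \<Rightarrow> real) set \<Rightarrow> ('x \<Rightarrow> 'x \<Rightarrow> 'a) \<Rightarrow> ('x \<Rightarrow> 'x) \<Rightarrow>
   real \<Rightarrow> ('i \<Rightarrow> 'x) \<Rightarrow> bool" where
  "tight_K_frame sc S ip Ks A \<xi>s \<longleftrightarrow>
     (\<forall>x. sn_has_sum S (\<lambda>i. ip x (\<xi>s i) * ip (\<xi>s i) x) UNIV (sc (complex_of_real A) (ip (Ks x) (Ks x))))"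

end

theory Submission
  imports Defs
begin

text \<open>
  Expanding the frame sum of \<open>\<xi>\<^sub>i + \<eta>\<^sub>i\<close> leaves the two Parseval sums and two cross sums, adjoint to
  each other. One cross sum is the image of \<open>\<Sum>\<^sub>i \<langle>x, \<eta>\<^sub>i\<rangle> \<xi>\<^sub>i = L\<^sub>1 L\<^sub>2\<^sup>* x = 0\<close> under \<open>\<langle>\<cdot>, x\<rangle>\<close>, so
  everything rests on the continuity of \<open>\<langle>\<cdot>, x\<rangle>\<close>, i.e. on a Cauchy--Schwarz inequality, up to a
  constant factor. This reduces to \<open>p (b\<^sup>* b) \<le> 3 p (b\<^sup>* b + v\<^sup>* v)\<close> for a single C*-seminorm \<open>p\<close>.

  Since the algebra need not be complete for \<open>p\<close> alone, spectral theory is avoided: positivity of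
  \<open>w\<close> is replaced by accretivity, \<open>p y \<le> p ((1 + t w) y)\<close> for all \<open>y\<close> and \<open>t \<ge> 0\<close>, which is
  equivalent to \<open>p (1 - t w) \<le> 1 + O(t\<^sup>2)\<close>. Squares of self-adjoint \<open>a\<close> are accretive
  because \<open>1 + t\<^sup>2 a\<^sup>2 = (1 + i t a) (1 - i t a)\<close>.
  That \<open>h = v\<^sup>* v\<close> is accretive follows by a variant of Kaplansky's argument: \<open>h \<le> \<mu>\<close> gives
  \<open>v v\<^sup>* \<le> \<mu>\<close>, hence \<open>h \<ge> - \<mu>\<close> as \<open>v\<^sup>* v + v v\<^sup>*\<close> is a sum of squares; replacing \<open>v\<close> by
  \<open>v (3 - h)\<close> (after scaling to \<open>\<mu> = 3\<close>) improves this lower bound by a factor \<open>4/27\<close>, and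
  iterating pushes it to \<open>0\<close>.
\<close>

subsection \<open>Accretive elements for a C*-seminorm\<close>

lemma star_algebraD:
  assumes "star_algebra st sc"
  shows "sc 1 a = a"
    and "sc (c * d) a = sc c (sc d a)"
    and "sc (c + d) a = sc c a + sc d a"
    and "sc c (a + b) = sc c a + sc c b"
    and "sc c (a * b) = sc c a * b"
    and "sc c (a * b) = a * sc c b"
    and "st (st a) = a"
    and "st (a + b) = st a + st b"
    and "st (a * b) = st b * st a"
    and "st (sc c a) = sc (cnj c) (st a)"
  using assms unfolding star_algebra_def by metis+

lemma c_star_seminormD:
  assumes "c_star_seminorm st sc p"
  shows "0 \<le> p a"
    and "p (a + b) \<le> p a + p b"
    and "p (sc c a) = cmod c * p a"
    and "p (a * b) \<le> p a * p b"
    and "p (st a * a) = (p a)\<^sup>2"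
  using assms unfolding c_star_seminorm_def by metis+

text \<open>The C*-identity and submultiplicativity give
  \<open>(p b)\<^sup>2 <= p (st b) * p b\<close>. Cancel \<open>p b\<close>, then use this for both
  \<open>a\<close> and \<open>st a\<close>.\<close>

lemma c_star_seminorm_st:
  assumes "star_algebra st sc" "c_star_seminorm st sc p"
  shows "p (st a) = p a"
proof -
  have le: "p b \<le> p (st b)" for b
  proof (cases "p b = 0")
    case True
    then show ?thesis using c_star_seminormD(1)[OF assms(2)] by simp
  next
    case False
    then have "0 < p b"
      using c_star_seminormD(1)[OF assms(2), of b] by simp
    moreover have "p b * p b \<le> p (st b) * p b"
      using c_star_seminormD(4,5)[OF assms(2)] by (metis power2_eq_square)
    ultimately show ?thesis by simp
  qed
  from le[of a] le[of "st a"] show ?thesis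
    by (simp add: star_algebraD(7)[OF assms(1)])
qed

text \<open>By the C*-identity \<open>p 1\<close> is 0 or 1. If it is 0, then \<open>p\<close>
  vanishes identically; \<open>c_star_seminorm_star_mult_le_sum\<close> splits that case
  off.\<close>

locale unital_C_star_seminorm =
  fixes st :: "'a::ring_1 \<Rightarrow> 'a" and sc :: "complex \<Rightarrow> 'a \<Rightarrow> 'a" and p :: "'a \<Rightarrow> real"
  assumes star_algebra: "star_algebra st sc"
    and seminorm: "c_star_seminorm st sc p"
    and p_one: "p 1 = 1"
begin

abbreviation rscale :: "real \<Rightarrow> 'a \<Rightarrow> 'a" (infixr "\<odot>" 75) where
  "t \<odot> a \<equiv> sc (complex_of_real t) a"

lemma sc_one [simp]: "sc 1 a = a"
  and sc_sc [simp]: "sc c (sc d a) = sc (c * d) a"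
  and sc_add_left: "sc (c + d) a = sc c a + sc d a"
  and sc_add_right: "sc c (a + b) = sc c a + sc c b"
  and mult_sc_left [simp]: "sc c a * b = sc c (a * b)"
  and mult_sc_right [simp]: "a * sc c b = sc c (a * b)"
  and st_st [simp]: "st (st a) = a"
  and st_add [simp]: "st (a + b) = st a + st b"
  and st_mult [simp]: "st (a * b) = st b * st a"
  and st_sc [simp]: "st (sc c a) = sc (cnj c) (st a)"
  using star_algebraD[OF star_algebra] by metis+

lemma sc_zero_left [simp]: "sc 0 a = 0"
  using sc_add_left[of 0 0 a] by simp

lemma sc_zero_right [simp]: "sc c 0 = 0"
  using sc_add_right[of c 0 0] by simp

lemma sc_minus_left [simp]: "sc (- c) a = - sc c a"
  using sc_add_left[of "- c" c a] by (simp add: eq_neg_iff_add_eq_0)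

lemma sc_minus_right [simp]: "sc c (- a) = - sc c a"
  using sc_add_right[of c "- a" a] by (simp add: eq_neg_iff_add_eq_0)

lemma sc_diff_left: "sc (c - d) a = sc c a - sc d a"
  using sc_add_left[of c "- d" a] by simp

lemma sc_diff_right: "sc c (a - b) = sc c a - sc c b"
  using sc_add_right[of c a "- b"] by simp

lemmas sc_distribs = sc_add_left sc_add_right sc_diff_left sc_diff_right

lemma sc_numeral: "sc (numeral n) a = numeral n * a"
proof -
  have "sc (of_nat k) a = of_nat k * a" for k
    by (induction k) (simp_all add: sc_add_left algebra_simps)
  from this[of "numeral n"] show ?thesis by simp
qed

lemma mult_numeral_commute: "a * numeral n = numeral n * (a :: 'a)"
  using mult_sc_right[of a "numeral n" 1] by (simp add: sc_numeral)

lemma st_zero [simp]: "st 0 = 0"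
  using st_add[of 0 0] by simp

lemma st_minus [simp]: "st (- a) = - st a"
  using st_add[of "- a" a] by (simp add: eq_neg_iff_add_eq_0)

lemma st_diff [simp]: "st (a - b) = st a - st b"
  using st_add[of a "- b"] by simp

lemma st_one [simp]: "st 1 = 1"
  using st_mult[of "st 1" 1] by simp

lemma st_power [simp]: "st (a ^ n) = st a ^ n"
  by (induction n) (simp_all add: power_commutes)

lemma st_numeral [simp]: "st (numeral n) = numeral n"
  using st_sc[of "numeral n" 1] by (simp add: sc_numeral)

lemma p_nonneg [simp]: "0 \<le> p a"
  and p_triangle: "p (a + b) \<le> p a + p b"
  and p_sc [simp]: "p (sc c a) = cmod c * p a"
  and p_mult: "p (a * b) \<le> p a * p b"
  and p_st_mult: "p (st a * a) = (p a)\<^sup>2"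
  using c_star_seminormD[OF seminorm] by blast+

lemma p_zero [simp]: "p 0 = 0"
  using p_sc[of 0 0] by simp

lemma p_minus [simp]: "p (- a) = p a"
  using p_sc[of "-1" a] by simp

lemma p_triangle_diff: "p (a - b) \<le> p a + p b"
  using p_triangle[of a "- b"] by simp

lemma p_power: "p (a ^ n) \<le> p a ^ n"
proof (induction n)
  case (Suc n)
  have "p (a ^ Suc n) \<le> p a * p (a ^ n)"
    using p_mult by simp
  also have "\<dots> \<le> p a ^ Suc n"
    using Suc by (simp add: mult_left_mono)
  finally show ?case .
qed (simp add: p_one)

lemma p_st [simp]: "p (st a) = p a"
  by (rule c_star_seminorm_st[OF star_algebra seminorm])

lemma p_square_self_adjoint:
  assumes "st a = a"
  shows "p (a * a) = (p a)\<^sup>2"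
  using p_st_mult[of a] assms by simp

text \<open>Iterated C*-identity. It replaces the spectral radius formula: growth bounds on the
  powers with exponents \<open>2 ^ k\<close> bound \<open>p a\<close> itself.\<close>

lemma p_power_self_adjoint:
  assumes "st a = a"
  shows "p (a ^ (2 ^ k)) = p a ^ (2 ^ k)"
proof (induction k)
  case (Suc k)
  have "a ^ (2 ^ Suc k) = a ^ (2 ^ k) * a ^ (2 ^ k)"
    by (simp add: power_add[symmetric] mult_2)
  moreover have "p a ^ (2 ^ Suc k) = (p a ^ (2 ^ k))\<^sup>2"
    by (simp add: power_mult[symmetric] mult.commute)
  ultimately show ?case
    using Suc p_square_self_adjoint[of "a ^ (2 ^ k)"] assms by simp
qed simp

section \<open>Accretivity: criteria and closure properties\<close>

definition accretive :: "'a \<Rightarrow> bool" where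
  "accretive w \<longleftrightarrow> (\<forall>t\<ge>0. \<forall>y. p y \<le> p (y + t \<odot> (w * y)))"

lemma accretiveD:
  assumes "accretive w" "0 \<le> t"
  shows "p y \<le> p (y + t \<odot> (w * y))"
  using assms unfolding accretive_def by blast

text \<open>For small \<open>e\<close>, write \<open>2 y\<close> as \<open>e / t\<close> times
  \<open>(1 + t w) y\<close> plus \<open>(1 - e / t) y + (1 - e w) y\<close>. The bound on the last
  term costs \<open>c e\<^sup>2 p y\<close>, which is still of order \<open>e\<close> after division
  by \<open>e / t\<close> and disappears as \<open>e\<close> tends to 0.\<close>

lemma accretiveI_quadratic:
  assumes bound: "\<And>t. 0 < t \<Longrightarrow> t < \<delta> \<Longrightarrow> p (1 - t \<odot> w) \<le> 1 + c * t\<^sup>2" and "0 < \<delta>"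
  shows "accretive w"
  unfolding accretive_def
proof (intro allI impI)
  fix t :: real and y
  assume "0 \<le> t"
  show "p y \<le> p (y + t \<odot> (w * y))"
  proof (cases "t = 0")
    case False
    with \<open>0 \<le> t\<close> have t: "0 < t" by simp
    let ?P = "p (y + t \<odot> (w * y))"
    have main: "p y \<le> ?P + e * (c * t * p y)" if e: "0 < e" "e < \<delta>" "e < t" for e
    proof -
      have "2 * y = (e / t) \<odot> (y + t \<odot> (w * y)) + ((1 - e / t) \<odot> y + (1 - e \<odot> w) * y)"
        using t by (simp add: sc_distribs algebra_simps mult_2)
      then have "p (2 * y) \<le> (e / t) * ?P + ((1 - e / t) * p y + p ((1 - e \<odot> w) * y))"
        using e t p_triangle[of "(e / t) \<odot> (y + t \<odot> (w * y))" "(1 - e / t) \<odot> y + (1 - e \<odot> w) * y"]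
          p_triangle[of "(1 - e / t) \<odot> y" "(1 - e \<odot> w) * y"]
        by (simp del: of_real_diff of_real_divide)
      also have "p ((1 - e \<odot> w) * y) \<le> (1 + c * e\<^sup>2) * p y"
        using p_mult[of "1 - e \<odot> w" y] bound[OF e(1,2)] p_nonneg[of y]
        by (meson mult_right_mono order_trans)
      also have "p (2 * y) = 2 * p y"
        using p_sc[of 2 y] by (simp add: sc_numeral)
      finally have "(e / t) * p y \<le> (e / t) * ?P + c * e\<^sup>2 * p y"
        by (simp add: algebra_simps)
      then have "(t / e) * ((e / t) * p y) \<le> (t / e) * ((e / t) * ?P + c * e\<^sup>2 * p y)"
        using e t by (intro mult_left_mono) auto
      also have "(t / e) * ((e / t) * p y) = p y"
        using e t by simp
      also have "(t / e) * ((e / t) * ?P + c * e\<^sup>2 * p y) = ?P + e * (c * t * p y)"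
        using e t by (simp add: distrib_left power2_eq_square)
      finally show ?thesis .
    qed
    have "((\<lambda>e. ?P + e * (c * t * p y)) \<longlongrightarrow> ?P + 0 * (c * t * p y)) (at_right 0)"
      by (intro tendsto_intros)
    moreover have "eventually (\<lambda>e. p y \<le> ?P + e * (c * t * p y)) (at_right 0)"
      unfolding eventually_at_right_field
      using main t \<open>0 < \<delta>\<close> by (intro exI[of _ "min \<delta> t"]) auto
    ultimately show ?thesis
      using tendsto_lowerbound by fastforce
  qed simp
qed

text \<open>Take \<open>y = 1 - t w\<close> in the definition:
  \<open>(1 + t w) (1 - t w) = 1 - (t w)\<^sup>2\<close>.\<close>

lemma accretive_imp_le_square:
  assumes "accretive w" "0 \<le> t"
  shows "p (1 - t \<odot> w) \<le> p (1 - (t \<odot> w) * (t \<odot> w))"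
  using accretiveD[OF assms, of "1 - t \<odot> w"] by (simp add: sc_distribs algebra_simps)

lemma accretive_imp_quadratic:
  assumes "accretive w" "0 \<le> t"
  shows "p (1 - t \<odot> w) \<le> 1 + (p w)\<^sup>2 * t\<^sup>2"
proof -
  have "p (1 - t \<odot> w) \<le> 1 + p ((t \<odot> w) * (t \<odot> w))"
    using accretive_imp_le_square[OF assms] p_triangle_diff[of 1 "(t \<odot> w) * (t \<odot> w)"] p_one by simp
  also have "p ((t \<odot> w) * (t \<odot> w)) \<le> (t * p w) * (t * p w)"
    using p_mult[of "t \<odot> w" "t \<odot> w"] assms by simp
  finally show ?thesis by (simp add: power2_eq_square algebra_simps)
qed

text \<open>\<open>1 - t (v + w)\<close> is the mean of \<open>1 - 2 t v\<close> and
  \<open>1 - 2 t w\<close>, and quadratic bounds survive taking means.\<close>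

lemma accretive_add:
  assumes "accretive v" "accretive w"
  shows "accretive (v + w)"
proof (rule accretiveI_quadratic)
  fix t :: real
  assume "0 < t"
  have "2 \<odot> (1 - t \<odot> (v + w)) = (1 - (2 * t) \<odot> v) + (1 - (2 * t) \<odot> w)"
    by (simp add: sc_distribs) (simp add: sc_numeral algebra_simps mult_2)
  then have "2 * p (1 - t \<odot> (v + w)) \<le> p (1 - (2 * t) \<odot> v) + p (1 - (2 * t) \<odot> w)"
    by (metis p_triangle p_sc norm_of_real abs_numeral)
  also have "\<dots> \<le> 2 * (1 + (2 * (p v)\<^sup>2 + 2 * (p w)\<^sup>2) * t\<^sup>2)"
    using accretive_imp_quadratic[OF assms(1), of "2 * t"]
      accretive_imp_quadratic[OF assms(2), of "2 * t"] \<open>0 < t\<close>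
    by (simp add: algebra_simps power_mult_distrib)
  finally show "p (1 - t \<odot> (v + w)) \<le> 1 + (2 * (p v)\<^sup>2 + 2 * (p w)\<^sup>2) * t\<^sup>2"
    by simp
qed (rule zero_less_one)

lemma accretive_scale:
  assumes "accretive w" "0 \<le> s"
  shows "accretive (s \<odot> w)"
  unfolding accretive_def
proof (intro allI impI)
  fix t :: real and y
  assume "0 \<le> t"
  then show "p y \<le> p (y + t \<odot> (s \<odot> w * y))"
    using accretiveD[OF assms(1), of "t * s" y] assms(2) by simp
qed

lemma accretive_scale_iff:
  assumes "0 < s"
  shows "accretive (s \<odot> w) \<longleftrightarrow> accretive w"
  using accretive_scale[of w s] accretive_scale[of "s \<odot> w" "1 / s"] assms by auto

text \<open>Triangle inequality for \<open>(1 + t \<mu>) y = (1 + t (\<mu> - c)) y + t c y\<close>,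
  whose last term has seminorm at most \<open>t \<mu> p y\<close>.\<close>

lemma accretive_scalar_minus:
  assumes "p c \<le> \<mu>"
  shows "accretive (\<mu> \<odot> 1 - c)"
  unfolding accretive_def
proof (intro allI impI)
  fix t :: real and y
  assume t: "0 \<le> t"
  have \<mu>: "0 \<le> \<mu>" using assms p_nonneg[of c] by linarith
  have "(1 + t * \<mu>) \<odot> y = (y + t \<odot> ((\<mu> \<odot> 1 - c) * y)) + t \<odot> (c * y)"
    by (simp add: sc_distribs algebra_simps)
  then have "(1 + t * \<mu>) * p y \<le> p (y + t \<odot> ((\<mu> \<odot> 1 - c) * y)) + t * p (c * y)"
    using p_triangle[of "y + t \<odot> ((\<mu> \<odot> 1 - c) * y)" "t \<odot> (c * y)"]
      p_sc[of "1 + t * \<mu>" y] norm_of_real[where 'a=complex, of "1 + t * \<mu>"] t \<mu>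
    by simp
  moreover have "t * p (c * y) \<le> t * (\<mu> * p y)"
    using p_mult[of c y] assms t by (intro mult_left_mono) (meson mult_right_mono order_trans p_nonneg)
  ultimately show "p y \<le> p (y + t \<odot> ((\<mu> \<odot> 1 - c) * y))"
    by (simp add: algebra_simps)
qed

lemma accretive_scalar:
  assumes "0 \<le> \<mu>"
  shows "accretive (\<mu> \<odot> 1)"
  using accretive_scalar_minus[of 0 \<mu>] assms by simp

lemma accretive_closed:
  assumes "\<And>e. 0 < e \<Longrightarrow> \<exists>v. accretive v \<and> p (v - w) \<le> e"
  shows "accretive w"
  unfolding accretive_def
proof (intro allI impI)
  fix t :: real and y
  assume t: "0 \<le> t"
  show "p y \<le> p (y + t \<odot> (w * y))"
  proof (rule field_le_epsilon)
    fix e :: real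
    assume e: "0 < e"
    define d where "d = e / (t * p y + 1)"
    have pos: "0 < t * p y + 1" using t by (simp add: add_nonneg_pos)
    obtain v where v: "accretive v" "p (v - w) \<le> d"
      using assms[of d] e pos by (auto simp: d_def)
    have "y + t \<odot> (v * y) = (y + t \<odot> (w * y)) + t \<odot> ((v - w) * y)"
      by (simp add: sc_distribs algebra_simps)
    then have "p y \<le> p (y + t \<odot> (w * y)) + t * p ((v - w) * y)"
      using p_triangle[of "y + t \<odot> (w * y)" "t \<odot> ((v - w) * y)"] accretiveD[OF v(1) t, of y] t
      by (simp only: p_sc norm_of_real abs_of_nonneg)
    moreover have "t * p ((v - w) * y) \<le> t * (d * p y)"
      using p_mult[of "v - w" y] v(2) t
      by (intro mult_left_mono) (meson mult_right_mono order_trans p_nonneg)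
    moreover have "t * (d * p y) \<le> e"
      using e pos by (simp add: d_def field_simps)
    ultimately show "p y \<le> p (y + t \<odot> (w * y)) + e" by linarith
  qed
qed

lemma accretive_square:
  assumes "st a = a"
  shows "accretive (a * a)"
proof -
  \<comment> \<open>Accretivity does not presuppose self-adjointness, so the two skew-adjoint
    factors can be treated separately. The C*-identity reduces each of them to
    \<open>1 + t\<^sup>2 a\<^sup>2\<close>.\<close>
  have acc: "accretive (sc c a)" if c: "c = \<i> \<or> c = - \<i>" for c
  proof (rule accretiveI_quadratic)
    fix t :: real
    assume t: "0 < t"
    have "(p (1 - t \<odot> sc c a))\<^sup>2 = p (1 + t\<^sup>2 \<odot> (a * a))"
      unfolding p_st_mult[symmetric]
      using c assms by (elim disjE) (simp_all add: sc_distribs algebra_simps power2_eq_square)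
    also have "\<dots> \<le> 1 + t\<^sup>2 * (p a)\<^sup>2"
      using p_triangle[of 1 "t\<^sup>2 \<odot> (a * a)"] p_one p_square_self_adjoint[OF assms]
      by (simp add: norm_power)
    also have "\<dots> \<le> (1 + (p a)\<^sup>2 * t\<^sup>2)\<^sup>2"
      using t by (simp add: power2_eq_square algebra_simps)
    finally show "p (1 - t \<odot> sc c a) \<le> 1 + (p a)\<^sup>2 * t\<^sup>2"
      by (rule power2_le_imp_le) simp
  qed (rule zero_less_one)
  show ?thesis
    unfolding accretive_def
  proof (intro allI impI)
    fix t :: real and y
    assume "0 \<le> t"
    define s where "s = sqrt t"
    have s: "0 \<le> s" "t = s * s" using \<open>0 \<le> t\<close> by (simp_all add: s_def)
    define z where "z = y + s \<odot> (sc (- \<i>) a * y)"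
    have "p y \<le> p z"
      unfolding z_def by (rule accretiveD[OF acc s(1)]) simp
    also have "\<dots> \<le> p (z + s \<odot> (sc \<i> a * z))"
      by (rule accretiveD[OF acc s(1)]) simp
    also have "z + s \<odot> (sc \<i> a * z) = y + t \<odot> (a * a * y)"
      by (simp add: z_def s(2) sc_distribs algebra_simps)
    finally show "p y \<le> p (y + t \<odot> (a * a * y))" .
  qed
qed

text \<open>This removes the quadratic error term. With \<open>x = t w\<close>,
  \<open>accretive_imp_le_square\<close> passes from \<open>1 - x\<close> to
  \<open>1 - x\<^sup>2\<close>. As the square of a self-adjoint element, \<open>x\<^sup>2\<close> is
  accretive again, so the step repeats, and \<open>x ^ (2 ^ k)\<close> tends to 0 because
  \<open>p x < 1\<close>.\<close>

lemma accretive_imp_contraction: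
  assumes acc: "accretive w" and sa: "st w = w" and t: "0 \<le> t" "t * p w < 1"
  shows "p (1 - t \<odot> w) \<le> 1"
proof -
  define x where "x = t \<odot> w"
  have x: "st x = x" "p x < 1" "p x = t * p w" using sa t by (simp_all add: x_def)
  have le: "p (1 - x) \<le> p (1 - x ^ (2 ^ k))" for k
  proof (induction k)
    case (Suc k)
    have "accretive (x ^ (2 ^ k))"
    proof (cases k)
      case 0
      then show ?thesis using accretive_scale[OF acc t(1)] by (simp add: x_def)
    next
      case (Suc j)
      then show ?thesis
        using accretive_square[of "x ^ (2 ^ j)"] x(1) by (simp add: power_add[symmetric] mult_2)
    qed
    then have "p (1 - x ^ (2 ^ k)) \<le> p (1 - x ^ (2 ^ k) * x ^ (2 ^ k))"
      using accretive_imp_le_square[of "x ^ (2 ^ k)" 1] by simp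
    then show ?case
      using Suc by (simp add: power_add[symmetric] mult_2)
  qed simp
  have "p (1 - x) \<le> 1 + p x ^ (2 ^ k)" for k
    using le[of k] p_triangle_diff[of 1 "x ^ (2 ^ k)"] p_one p_power[of x "2 ^ k"] by simp
  moreover have "(\<lambda>k. 1 + p x ^ (2 ^ k)) \<longlonglongrightarrow> 1 + 0"
  proof (intro tendsto_add tendsto_const)
    have "(\<lambda>n. p x ^ n) \<longlonglongrightarrow> 0"
      using x(2) by (intro LIMSEQ_power_zero) simp
    then show "(\<lambda>k. p x ^ (2 ^ k)) \<longlonglongrightarrow> 0"
      by (rule filterlim_compose) (rule filterlim_subseq, simp add: strict_mono_def)
  qed
  ultimately have "p (1 - x) \<le> 1"
    by (intro LIMSEQ_le_const[of "\<lambda>k. 1 + p x ^ (2 ^ k)"]) auto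
  then show ?thesis by (simp add: x_def)
qed

section \<open>Approximate square roots\<close>

text \<open>Visser's iteration: for \<open>p x \<le> 1\<close> the elements \<open>1 - visser x n\<close> are approximate square
  roots of \<open>1 - x\<close>. They are polynomials in \<open>x\<close>, so no completeness is needed.\<close>
primrec visser :: "'a \<Rightarrow> nat \<Rightarrow> 'a" where
  "visser x 0 = 0"
| "visser x (Suc n) = (1 / 2) \<odot> (x + visser x n * visser x n)"

lemma visser_commute:
  assumes "q * x = x * q"
  shows "q * visser x n = visser x n * q"
proof (induction n)
  case (Suc n)
  have "q * (visser x n * visser x n) = visser x n * visser x n * q"
    using Suc by (metis mult.assoc)
  then show ?case
    using assms by (simp add: algebra_simps)
qed simp

lemma st_visser:
  assumes "st x = x"
  shows "st (visser x n) = visser x n"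
  by (induction n) (simp_all add: assms)

text \<open>The error of \<open>1 - visser x n\<close> as a square root of \<open>1 - x\<close> is
  twice the next increment, so it suffices that the increments tend to 0.\<close>

lemma one_minus_visser_square:
  "(1 - visser x n) * (1 - visser x n) = (1 - x) + 2 \<odot> (visser x (Suc n) - visser x n)"
  by (simp add: sc_distribs) (simp add: sc_numeral algebra_simps mult_2)

lemma visser_difference_tendsto_0:
  assumes "p x \<le> 1"
  shows "(\<lambda>n. p (visser x (Suc n) - visser x n)) \<longlonglongrightarrow> 0"
proof -
  \<comment> \<open>The same iteration for the real number 1 is a majorant: its increments dominate
    those of \<open>visser x\<close>, and they tend to 0 because \<open>\<beta>\<close> is
    increasing and bounded.\<close>
  define \<beta> :: "nat \<Rightarrow> real" where "\<beta> = rec_nat 0 (\<lambda>_ b. (1 + b * b) / 2)"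
  have \<beta>: "\<beta> 0 = 0" "\<beta> (Suc n) = (1 + \<beta> n * \<beta> n) / 2" for n
    by (simp_all add: \<beta>_def)
  have \<beta>_range: "0 \<le> \<beta> n \<and> \<beta> n \<le> 1" for n
  proof (induction n)
    case (Suc n)
    then have "\<beta> n * \<beta> n \<le> 1" by (simp add: mult_le_one)
    then show ?case using Suc by (simp add: \<beta>)
  qed (simp add: \<beta>)
  have p_le: "p (visser x n) \<le> \<beta> n" for n
  proof (induction n)
    case (Suc n)
    have "p (x + visser x n * visser x n) \<le> 1 + \<beta> n * \<beta> n"
      using p_triangle[of x "visser x n * visser x n"] p_mult[of "visser x n" "visser x n"]
        assms mult_mono[OF Suc Suc] \<beta>_range[of n] by simp
    then show ?case by (simp add: \<beta> norm_divide)
  qed (simp add: \<beta>)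
  have p_diff_le: "p (visser x (Suc n) - visser x n) \<le> \<beta> (Suc n) - \<beta> n" for n
  proof (induction n)
    case 0
    show ?case using assms by (simp add: \<beta> norm_divide)
  next
    case (Suc n)
    let ?u = "visser x (Suc n)" and ?v = "visser x n"
    have comm: "?u * ?v = ?v * ?u"
      by (metis visser_commute)
    have "visser x (Suc (Suc n)) - ?u = (1 / 2) \<odot> ((x + ?u * ?u) - (x + ?v * ?v))"
      by (simp only: visser.simps(2)[of x "Suc n"] visser.simps(2)[of x n] sc_diff_right)
    also have "(x + ?u * ?u) - (x + ?v * ?v) = (?u - ?v) * (?u + ?v)"
      by (simp only: ring_distribs comm diff_diff_eq2 add_diff_cancel_left) (simp add: algebra_simps del: visser.simps)
    finally have "visser x (Suc (Suc n)) - ?u = (1 / 2) \<odot> ((?u - ?v) * (?u + ?v))" .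
    then have "p (visser x (Suc (Suc n)) - ?u) = p ((?u - ?v) * (?u + ?v)) / 2"
      by (simp only: p_sc norm_of_real)
    also have "p ((?u - ?v) * (?u + ?v)) \<le> p (?u - ?v) * p (?u + ?v)"
      by (rule p_mult)
    also have "\<dots> \<le> (\<beta> (Suc n) - \<beta> n) * (\<beta> (Suc n) + \<beta> n)"
    proof (rule mult_mono[OF Suc])
      show "p (?u + ?v) \<le> \<beta> (Suc n) + \<beta> n"
        using p_triangle[of ?u ?v] p_le[of n] p_le[of "Suc n"] by linarith
      show "0 \<le> \<beta> (Suc n) - \<beta> n"
        using Suc p_nonneg order_trans by blast
    qed simp
    also have "(\<beta> (Suc n) - \<beta> n) * (\<beta> (Suc n) + \<beta> n) / 2 = \<beta> (Suc (Suc n)) - \<beta> (Suc n)"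
      by (simp only: \<beta>(2)[of "Suc n"] \<beta>(2)[of n]) (simp add: field_simps)
    finally show ?case by simp
  qed
  have "0 \<le> \<beta> (Suc n) - \<beta> n" for n
    using p_diff_le[of n] p_nonneg order_trans by blast
  then have "incseq \<beta>"
    by (intro incseq_SucI) (simp add: le_diff_eq)
  then have "convergent \<beta>"
    using incseq_convergent[of \<beta> 1] \<beta>_range by (metis convergentI)
  then obtain l where "\<beta> \<longlonglongrightarrow> l"
    by (auto simp: convergent_def)
  then have "(\<lambda>n. \<beta> (Suc n) - \<beta> n) \<longlonglongrightarrow> l - l"
    by (intro tendsto_diff LIMSEQ_Suc)
  then have "(\<lambda>n. \<beta> (Suc n) - \<beta> n) \<longlonglongrightarrow> 0"
    by simp
  then show ?thesis
    by (rule Lim_null_comparison[rotated]) (simp add: p_diff_le del: visser.simps)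
qed

text \<open>For suitable \<open>t\<close>, \<open>accretive_imp_contraction\<close> gives
  \<open>p (1 - t w) <= 1\<close>, so Visser's iteration applies to \<open>x = 1 - t w\<close>. The
  root is a polynomial in \<open>w\<close>, which explains its self-adjointness and the commutation
  property.\<close>

lemma accretive_approx_square:
  assumes acc: "accretive w" and sa: "st w = w" and e: "0 < e"
  obtains r where "st r = r" "\<And>q. q * w = w * q \<Longrightarrow> q * r = r * q" "p (r * r - w) \<le> e"
proof -
  define t where "t = 1 / (p w + 1)"
  have pw: "0 < p w + 1" using p_nonneg[of w] by linarith
  have t: "0 < t" "t * p w < 1" using pw by (simp_all add: t_def field_simps)
  define x where "x = 1 - t \<odot> w"
  have x: "st x = x" "p x \<le> 1"
    using accretive_imp_contraction[OF acc sa _ t(2)] t(1) sa by (simp_all add: x_def)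
  have "eventually (\<lambda>n. p (visser x (Suc n) - visser x n) < e * t / 2) sequentially"
    using e t(1) by (intro order_tendstoD(2)[OF visser_difference_tendsto_0[OF x(2)]]) simp
  then obtain n where n: "p (visser x (Suc n) - visser x n) < e * t / 2"
    by (meson eventually_sequentially order_refl)
  define r where "r = (1 / sqrt t) \<odot> (1 - visser x n)"
  have "st r = r" using st_visser[OF x(1)] by (simp add: r_def)
  moreover have "q * r = r * q" if "q * w = w * q" for q
  proof -
    have "q * x = x * q" using that by (simp add: x_def algebra_simps)
    from visser_commute[OF this] show ?thesis by (simp add: r_def algebra_simps)
  qed
  moreover have "p (r * r - w) \<le> e"
  proof -
    have "r * r = (1 / t) \<odot> ((1 - visser x n) * (1 - visser x n))"
      using t(1) by (simp add: r_def of_real_mult[symmetric] del: of_real_mult)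
    also have "\<dots> = w + (2 / t) \<odot> (visser x (Suc n) - visser x n)"
      unfolding one_minus_visser_square using t(1) by (simp add: x_def sc_add_right del: visser.simps)
    finally have "p (r * r - w) = (2 / t) * p (visser x (Suc n) - visser x n)"
      using t(1) by (simp del: visser.simps add: norm_divide)
    also have "\<dots> \<le> (2 / t) * (e * t / 2)"
      using n t(1) by (intro mult_left_mono) simp_all
    finally show ?thesis using t(1) by simp
  qed
  ultimately show thesis by (rule that)
qed

text \<open>If \<open>r\<close> is an approximate root of \<open>w\<close>, then
  \<open>q w q\<close> is close to the square of \<open>q r\<close>, which is self-adjoint because
  \<open>q\<close> and \<open>r\<close> commute.\<close>

lemma accretive_conjugate:
  assumes acc: "accretive w" and sa: "st w = w" "st q = q" and comm: "q * w = w * q"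
  shows "accretive (q * w * q)"
proof (rule accretive_closed)
  fix e :: real
  assume "0 < e"
  define d where "d = e / ((p q)\<^sup>2 + 1)"
  have d: "0 < d" "d * (p q)\<^sup>2 \<le> e"
    using \<open>0 < e\<close> by (simp_all add: d_def field_simps add_pos_nonneg)
  obtain r where r: "st r = r" "q * r = r * q" "p (r * r - w) \<le> d"
    using accretive_approx_square[OF acc sa(1) d(1)] comm by metis
  have "accretive ((q * r) * (q * r))"
    using r sa by (intro accretive_square) simp
  moreover have "(q * r) * (q * r) - q * w * q = q * ((r * r - w) * q)"
  proof -
    have "(q * r) * (q * r) = (q * r) * (r * q)"
      by (simp only: r(2))
    then show ?thesis by (simp add: algebra_simps)
  qed
  moreover have "p (q * ((r * r - w) * q)) \<le> p q * (d * p q)"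
    by (meson p_mult r(3) mult_mono mult_left_mono mult_right_mono order_trans p_nonneg)
  ultimately show "\<exists>v. accretive v \<and> p (v - q * w * q) \<le> e"
    using d(2) by (intro exI[of _ "(q * r) * (q * r)"]) (simp add: power2_eq_square algebra_simps)
qed

section \<open>Accretivity of \<open>st v * v\<close>\<close>

text \<open>Compare the powers \<open>(1 + s y y\<^sup>*)\<^sup>n = 1 + s y (\<Sum>\<^sub>j\<^sub><\<^sub>n (1 + s y\<^sup>* y)\<^sup>j) y\<^sup>*\<close>, for \<open>n\<close> a power of 2.\<close>
lemma p_one_plus_swap:
  "p (1 + s \<odot> (y * st y)) \<le> max 1 (p (1 + s \<odot> (st y * y)))"
proof -
  define a where "a = 1 + s \<odot> (y * st y)"
  define b where "b = 1 + s \<odot> (st y * y)"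
  define M where "M = max 1 (p b)"
  define C where "C = \<bar>s\<bar> * (p y)\<^sup>2"
  have M: "1 \<le> M" "p b \<le> M" by (simp_all add: M_def)
  have C: "0 \<le> C" by (simp add: C_def)
  have comm: "a ^ n * y = y * b ^ n" for n
  proof (induction n)
    case (Suc n)
    have "a * y = y * b" by (simp add: a_def b_def algebra_simps)
    then show ?case using Suc by (metis mult.assoc power_Suc2)
  qed simp
  have pow: "p (a ^ n) \<le> 1 + C * n * M ^ n" for n
  proof (induction n)
    case (Suc n)
    have "a ^ Suc n = a ^ n + s \<odot> ((a ^ n * y) * st y)"
      by (simp add: power_Suc2 a_def algebra_simps del: power_Suc)
    then have "a ^ Suc n = a ^ n + s \<odot> ((y * b ^ n) * st y)"
      by (simp only: comm)
    then have "p (a ^ Suc n) \<le> p (a ^ n) + \<bar>s\<bar> * p ((y * b ^ n) * st y)"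
      using p_triangle[of "a ^ n" "s \<odot> ((y * b ^ n) * st y)"] by (simp only: p_sc norm_of_real)
    also have "p ((y * b ^ n) * st y) \<le> (p y * M ^ n) * p y"
    proof -
      have "p (b ^ n) \<le> M ^ n"
        using p_power[of b n] power_mono[OF M(2), of n] by simp
      then show ?thesis
        using p_mult[of "y * b ^ n" "st y"] p_mult[of y "b ^ n"]
        by (smt (verit, best) mult_left_mono mult_right_mono p_nonneg p_st)
    qed
    also have "p (a ^ n) + \<bar>s\<bar> * ((p y * M ^ n) * p y) = p (a ^ n) + C * M ^ n"
      by (simp add: C_def power2_eq_square)
    also have "\<dots> \<le> 1 + C * (n + 1) * M ^ n"
      using Suc by (simp add: algebra_simps)
    also have "\<dots> \<le> 1 + C * (n + 1) * M ^ Suc n"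
      using M(1) C by (intro add_left_mono mult_left_mono power_increasing) simp_all
    finally show ?case by (simp add: mult_left_mono add.commute)
  qed (simp add: p_one)
  have sa: "st a = a" by (simp add: a_def)
  \<comment> \<open>Since \<open>a\<close> is self-adjoint, \<open>pow\<close> bounds
    \<open>(p a / M) ^ (2 ^ k)\<close> by \<open>1 + C * 2 ^ k\<close>. Exponential growth would
    beat this linear factor if \<open>p a\<close> exceeded \<open>M\<close>.\<close>
  have "p a / M \<le> 1"
  proof (rule ccontr)
    assume "\<not> p a / M \<le> 1"
    then have gt: "1 < p a / M" by simp
    have "(p a / M) ^ (2 ^ k) \<le> 1 + C * 2 ^ k" for k
    proof -
      have "p a ^ (2 ^ k) \<le> 1 + C * 2 ^ k * M ^ (2 ^ k)"
        using pow[of "2 ^ k"] p_power_self_adjoint[OF sa, of k] by simp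
      also have "\<dots> \<le> (1 + C * 2 ^ k) * M ^ (2 ^ k)"
        using M(1) by (simp add: algebra_simps)
      finally show ?thesis
        using M(1) by (simp add: power_divide field_simps)
    qed
    moreover have "((\<lambda>n. (1 + C * real n) / (p a / M) ^ n) \<longlongrightarrow> 0) sequentially"
    proof -
      have inv: "norm (1 / (p a / M)) < 1"
        using gt M(1) by (simp add: field_simps)
      have "(\<lambda>n. (1 / (p a / M)) ^ n + C * (real n * (1 / (p a / M)) ^ n)) \<longlonglongrightarrow> 0 + C * 0"
        by (intro tendsto_add tendsto_mult tendsto_const LIMSEQ_power_zero[OF inv] powser_times_n_limit_0[OF inv])
      then show ?thesis
        by (simp add: add_divide_distrib power_divide distrib_right mult.assoc)
    qed
    then have "(\<lambda>k. (1 + C * real (2 ^ k)) / (p a / M) ^ (2 ^ k)) \<longlonglongrightarrow> 0"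
      by (rule filterlim_compose) (rule filterlim_subseq, simp add: strict_mono_def)
    then have "eventually (\<lambda>k. (1 + C * real (2 ^ k)) / (p a / M) ^ (2 ^ k) < 1) sequentially"
      by (rule order_tendstoD) simp
    then obtain k where "(1 + C * real (2 ^ k)) / (p a / M) ^ (2 ^ k) < 1"
      by (meson eventually_sequentially order_refl)
    then have "1 + C * 2 ^ k < (p a / M) ^ (2 ^ k)"
      using gt M(1) by (auto simp: divide_less_eq_1 split: if_splits)
    ultimately show False by (simp add: not_le[symmetric])
  qed
  then show ?thesis
    unfolding a_def[symmetric] b_def[symmetric] M_def[symmetric] using M(1) by simp
qed

text \<open>\<open>1 - t (\<mu> - z)\<close> is a multiple of \<open>1 + s z\<close> with
  \<open>s = t / (1 - t \<mu>)\<close>, so \<open>p_one_plus_swap\<close> transfers the quadratic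
  bound. The restriction on \<open>t\<close> keeps \<open>1 - t \<mu>\<close> positive; multiplied
  by it, the 1 in the maximum stays below 1.\<close>

lemma accretive_swap:
  assumes acc: "accretive (\<mu> \<odot> 1 - st y * y)" and \<mu>: "0 \<le> \<mu>"
  shows "accretive (\<mu> \<odot> 1 - y * st y)"
proof (rule accretiveI_quadratic)
  fix t :: real
  assume t: "0 < t" "t < 1 / (\<mu> + 1)"
  have t\<mu>: "0 < 1 - t * \<mu>"
  proof -
    have "t * (\<mu> + 1) < 1" using t \<mu> by (simp add: field_simps)
    then show ?thesis using t by (simp add: algebra_simps)
  qed
  let ?s = "t / (1 - t * \<mu>)" and ?w = "\<mu> \<odot> 1 - st y * y"
  have scale: "1 - t \<odot> (\<mu> \<odot> 1 - z) = (1 - t * \<mu>) \<odot> (1 + ?s \<odot> z)" for z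
    using t\<mu> by (simp add: sc_add_right of_real_mult[symmetric] del: of_real_mult of_real_divide of_real_diff)
      (simp add: sc_distribs)
  have "p (1 - t \<odot> (\<mu> \<odot> 1 - y * st y)) = (1 - t * \<mu>) * p (1 + ?s \<odot> (y * st y))"
    unfolding scale using t\<mu> by (simp only: p_sc norm_of_real)
  also have "\<dots> \<le> (1 - t * \<mu>) * max 1 (p (1 + ?s \<odot> (st y * y)))"
    using t\<mu> by (intro mult_left_mono p_one_plus_swap) simp
  also have "\<dots> = max (1 - t * \<mu>) (p (1 - t \<odot> ?w))"
    unfolding scale using t\<mu> by (simp only: p_sc norm_of_real max_mult_distrib_left) simp
  also have "\<dots> \<le> 1 + (p ?w)\<^sup>2 * t\<^sup>2"
    using accretive_imp_quadratic[OF acc, of t] t \<mu> by (intro max.boundedI)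
      (simp_all add: order_trans[of "- (t * \<mu>)" 0])
  finally show "p (1 - t \<odot> (\<mu> \<odot> 1 - y * st y)) \<le> 1 + (p ?w)\<^sup>2 * t\<^sup>2" .
qed (use \<mu> in simp)

lemma accretive_scalar_plus_star_mult:
  assumes acc: "accretive (\<mu> \<odot> 1 - st y * y)" and \<mu>: "0 \<le> \<mu>"
  shows "accretive (\<mu> \<odot> 1 + st y * y)"
proof -
  \<comment> \<open>Twice the real part of \<open>y\<close> and, up to sign, twice its imaginary
    part; the mixed terms cancel in the sum of their squares.\<close>
  let ?a = "y + st y" and ?b = "sc \<i> (y - st y)"
  have "accretive (?a * ?a + ?b * ?b)"
    by (intro accretive_add accretive_square) (simp_all add: sc_diff_right)
  moreover have "?a * ?a + ?b * ?b = 2 \<odot> (st y * y + y * st y)"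
    by (simp add: sc_numeral) (simp add: algebra_simps mult_2)
  ultimately have "accretive (st y * y + y * st y)"
    using accretive_scale_iff[of 2] by simp
  from accretive_add[OF accretive_swap[OF acc \<mu>] this] show ?thesis by simp
qed

text \<open>After scaling to \<open>\<mu> = 3\<close>, the identities behind the factor \<open>4/27\<close> are
  \<open>4 - h (3 - h)\<^sup>2 = (h - 1)\<^sup>2 (4 - h)\<close> and \<open>9 h = h (3 - h)\<^sup>2 + h\<^sup>2 (6 - h)\<close>.\<close>
lemma accretive_star_mult_contract:
  assumes R: "\<And>y \<mu>. 0 \<le> \<mu> \<Longrightarrow> accretive (\<mu> \<odot> 1 - st y * y) \<Longrightarrow> accretive ((\<rho> * \<mu>) \<odot> 1 + st y * y)"
    and acc: "accretive (\<mu> \<odot> 1 - st v * v)" and \<mu>: "0 < \<mu>"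
  shows "accretive ((4 / 27 * \<rho> * \<mu>) \<odot> 1 + st v * v)"
proof -
  define u where "u = sqrt (3 / \<mu>) \<odot> v"
  define h where "h = st u * u"
  have h_eq: "h = (3 / \<mu>) \<odot> (st v * v)"
    using \<mu> by (simp add: h_def u_def of_real_mult[symmetric] del: of_real_mult of_real_divide)
  have sa: "st h = h" by (simp add: h_def)
  have "(3 / \<mu>) \<odot> (\<mu> \<odot> 1 - st v * v) = 3 - h"
    using \<mu> by (simp add: h_eq sc_diff_right) (simp add: sc_numeral)
  then have acc3: "accretive (3 - h)"
    using accretive_scale[OF acc, of "3 / \<mu>"] \<mu> by simp
  have acc_more: "accretive (4 - h)" "accretive (6 - h)"
    using accretive_add[OF acc3 accretive_scalar[of 1]] accretive_add[OF acc3 accretive_scalar[of 3]]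
    by (simp_all add: sc_numeral diff_add_eq)
  \<comment> \<open>Here \<open>st y * y\<close> is \<open>h (3 - h)\<^sup>2\<close>; as a real
    function this has maximum 4 on \<open>h <= 3\<close>, attained at 1.\<close>
  define y where "y = u * (3 - h)"
  have yy: "st y * y = (3 - h) * h * (3 - h)"
    by (simp add: y_def sa) (simp add: h_def mult.assoc)
  have num: "(3::'a) = 1 + 1 + 1" "(4::'a) = 1 + 1 + 1 + 1" "(6::'a) = 1 + 1 + 1 + 1 + 1 + 1"
    "(9::'a) = 1 + 1 + 1 + 1 + 1 + 1 + 1 + 1 + 1" by simp_all
  have "accretive ((h - 1) * (4 - h) * (h - 1))"
    by (rule accretive_conjugate[OF acc_more(1)]) (simp_all add: sa algebra_simps mult_numeral_commute)
  also have "(h - 1) * (4 - h) * (h - 1) = 4 - st y * y"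
    unfolding yy num by (simp only: ring_distribs mult_1_left mult_1_right) (simp add: algebra_simps)
  finally have "accretive (4 \<odot> 1 - st y * y)"
    by (simp add: sc_numeral)
  \<comment> \<open>The lower bound \<open>- 4 \<rho>\<close> for \<open>st y * y\<close> carries
    over to \<open>9 h\<close>, and \<open>9 h\<close> is \<open>27 / \<mu>\<close> times
    \<open>st v * v\<close>; hence the factor \<open>4 / 27\<close>.\<close>
  from R[OF _ this] have "accretive ((\<rho> * 4) \<odot> 1 + st y * y)" by simp
  moreover have "accretive (h * (6 - h) * h)"
    by (rule accretive_conjugate[OF acc_more(2)]) (simp_all add: sa algebra_simps mult_numeral_commute)
  ultimately have "accretive ((\<rho> * 4) \<odot> 1 + st y * y + h * (6 - h) * h)"
    by (rule accretive_add)
  also have "(\<rho> * 4) \<odot> 1 + st y * y + h * (6 - h) * h = (\<rho> * 4) \<odot> 1 + 9 * h"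
    unfolding yy num by (simp only: ring_distribs mult_1_left mult_1_right) (simp add: algebra_simps)
  also have "\<dots> = (27 / \<mu>) \<odot> ((4 / 27 * \<rho> * \<mu>) \<odot> 1 + st v * v)"
    using \<mu> by (simp add: h_eq sc_numeral[symmetric] sc_add_right mult.commute)
  finally show ?thesis
    by (subst (asm) accretive_scale_iff) (use \<mu> in simp)
qed

lemma accretive_star_mult: "accretive (st v * v)"
proof -
  \<comment> \<open>Both \<open>\<mu>\<close> and \<open>y\<close> must vary: the induction step
    uses the bound for a modified element, with 4 in place of \<open>\<mu>\<close>.\<close>
  have R: "accretive (((4 / 27) ^ n * \<mu>) \<odot> 1 + st y * y)"
    if "0 \<le> \<mu>" "accretive (\<mu> \<odot> 1 - st y * y)" for n \<mu> y
    using that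
  proof (induction n arbitrary: \<mu> y)
    case 0
    then show ?case using accretive_scalar_plus_star_mult by simp
  next
    case (Suc n)
    show ?case
    proof (cases "\<mu> = 0")
      case True
      then show ?thesis using accretive_scalar_plus_star_mult[OF Suc.prems(2,1)] by simp
    next
      case False
      then show ?thesis
        using accretive_star_mult_contract[OF Suc.IH Suc.prems(2)] Suc.prems(1)
        by (simp add: mult.assoc)
    qed
  qed
  define \<mu> where "\<mu> = (p v)\<^sup>2"
  have \<mu>: "0 \<le> \<mu>" "accretive (\<mu> \<odot> 1 - st v * v)"
    by (simp_all add: \<mu>_def accretive_scalar_minus p_st_mult del: of_real_power)
  show ?thesis
  proof (rule accretive_closed)
    fix e :: real
    assume e: "0 < e"
    have "(\<lambda>n. (4 / 27) ^ n * \<mu>) \<longlonglongrightarrow> 0 * \<mu>"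
      by (intro tendsto_mult LIMSEQ_power_zero tendsto_const) simp
    then have "eventually (\<lambda>n. (4 / 27) ^ n * \<mu> < e) sequentially"
      using e by (intro order_tendstoD(2)) simp_all
    then obtain n where n: "(4 / 27) ^ n * \<mu> < e"
      by (meson eventually_sequentially order_refl)
    have "p (((4 / 27) ^ n * \<mu>) \<odot> 1) = (4 / 27) ^ n * \<mu>"
      using \<mu>(1) by (simp only: p_sc norm_of_real p_one) simp
    then show "\<exists>w. accretive w \<and> p (w - st v * v) \<le> e"
      using R[OF \<mu>, of n] n by (intro exI[of _ "((4 / 27) ^ n * \<mu>) \<odot> 1 + st v * v"]) simp
  qed
qed

text \<open>Both \<open>g\<close> and \<open>\<mu> - g\<close> are accretive, the latter as
  \<open>\<mu> - (g + st v * v)\<close> plus \<open>st v * v\<close>. For small \<open>t\<close>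
  this gives \<open>p (1 - t g) <= 1\<close> and \<open>p (1 + t g) <= 1 + t \<mu>\<close>, and
  \<open>4 t g\<close> is the difference of the squares of \<open>1 + t g\<close> and
  \<open>1 - t g\<close>.\<close>

lemma p_star_mult_le_sum: "p (st b * b) \<le> 3 * p (st b * b + st v * v)"
proof -
  define g where "g = st b * b"
  define P where "P = p g"
  define \<mu> where "\<mu> = p (g + st v * v)"
  have nonneg: "0 \<le> P" "0 \<le> \<mu>" by (simp_all add: P_def \<mu>_def)
  have sa: "st g = g" by (simp add: g_def)
  have "P \<le> 3 * \<mu>"
  proof (cases "P + \<mu> = 0")
    case False
    then have pos: "0 < P + \<mu>" using nonneg by simp
    define t where "t = 9 / (10 * (P + \<mu>))"
    have t: "0 < t" "t * (P + \<mu>) = 9 / 10"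
      using pos by (simp_all add: t_def del: distrib_left_numeral)
    have "accretive (\<mu> \<odot> 1 - (g + st v * v) + st v * v)"
      by (intro accretive_add accretive_scalar_minus accretive_star_mult) (simp add: \<mu>_def)
    then have acc: "accretive (\<mu> \<odot> 1 - g)"
      by (simp add: algebra_simps)
    have lower: "p (1 - t \<odot> g) \<le> 1"
    proof (rule accretive_imp_contraction[OF _ sa])
      show "accretive g" by (simp add: g_def accretive_star_mult)
      have "t * P \<le> t * (P + \<mu>)" using t(1) nonneg by simp
      then show "t * p g < 1" using t(2) by (simp add: P_def)
    qed (use t(1) in simp)
    have "p (1 - t \<odot> (\<mu> \<odot> 1 - g)) \<le> 1"
    proof (rule accretive_imp_contraction[OF acc])
      have "p (\<mu> \<odot> 1 - g) \<le> P + \<mu>"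
        using p_triangle_diff[of "\<mu> \<odot> 1" g] nonneg(2) p_one by (simp add: P_def)
      then have "t * p (\<mu> \<odot> 1 - g) \<le> t * (P + \<mu>)"
        using t(1) by (intro mult_left_mono) simp_all
      then show "t * p (\<mu> \<odot> 1 - g) < 1" using t(2) by simp
    qed (use t(1) sa in simp_all)
    moreover have "1 + t \<odot> g = (1 - t \<odot> (\<mu> \<odot> 1 - g)) + (t * \<mu>) \<odot> 1"
      by (simp add: sc_distribs)
    ultimately have upper: "p (1 + t \<odot> g) \<le> 1 + t * \<mu>"
      using p_triangle[of "1 - t \<odot> (\<mu> \<odot> 1 - g)" "(t * \<mu>) \<odot> 1"] t(1) nonneg(2) p_one
      by (simp only: p_sc norm_of_real) simp
    have "(4 * t) \<odot> g = (1 + t \<odot> g) * (1 + t \<odot> g) - (1 - t \<odot> g) * (1 - t \<odot> g)"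
    proof -
      have "(4 * t) \<odot> g = (t + t + t + t) \<odot> g" by simp
      then show ?thesis by (simp only: of_real_add sc_distribs) (simp add: sc_distribs algebra_simps)
    qed
    then have "4 * t * P \<le> p ((1 + t \<odot> g) * (1 + t \<odot> g)) + p ((1 - t \<odot> g) * (1 - t \<odot> g))"
      using p_triangle_diff[of "(1 + t \<odot> g) * (1 + t \<odot> g)" "(1 - t \<odot> g) * (1 - t \<odot> g)"]
        p_sc[of "of_real (4 * t)" g] t(1) by (simp only: norm_of_real P_def)
    also have "\<dots> = (p (1 + t \<odot> g))\<^sup>2 + (p (1 - t \<odot> g))\<^sup>2"
      using sa by (simp add: p_square_self_adjoint)
    also have "\<dots> \<le> (1 + t * \<mu>)\<^sup>2 + 1\<^sup>2"
      by (intro add_mono power_mono upper lower p_nonneg)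
    also have "\<dots> = 2 + 2 * (t * \<mu>) + (t * \<mu>) * (t * \<mu>)"
      by (simp add: power2_eq_square algebra_simps)
    also have "\<dots> \<le> 2 + 3 * (t * \<mu>)"
    proof -
      have "t * \<mu> \<le> 1" "0 \<le> t * \<mu>"
        using mult_left_mono[of \<mu> "P + \<mu>" t] t(1) nonneg unfolding t(2) by simp_all
      then show ?thesis using mult_right_mono[of "t * \<mu>" 1 "t * \<mu>"] by linarith
    qed
    \<comment> \<open>The constant 2 is rewritten as \<open>20 / 9 * (t * (P + \<mu>))\<close> to
      make the estimate homogeneous. It yields \<open>P <= 47 / 16 * \<mu>\<close>, which is below
      \<open>3 * \<mu>\<close>.\<close>
    finally have "4 * (t * P) \<le> 20 / 9 * (t * (P + \<mu>)) + 3 * (t * \<mu>)"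
      using t(2) by simp
    then have "t * (16 * P) \<le> t * (47 * \<mu>)" unfolding distrib_left by linarith
    then show ?thesis using t(1) nonneg by simp
  qed (use nonneg in simp)
  then show ?thesis by (simp add: P_def \<mu>_def g_def)
qed

end

subsection \<open>Hilbert modules\<close>

lemma c_star_seminorm_star_mult_le_sum:
  assumes "star_algebra st sc" "c_star_seminorm st sc p"
  shows "p (st b * b) \<le> 3 * p (st b * b + st v * v)"
proof -
  have one: "st 1 = 1"
    using star_algebraD(7,9)[OF assms(1)] by (metis mult_1 mult_1_right)
  have "p 1 = 0 \<or> p 1 = 1"
    using c_star_seminormD(5)[OF assms(2), of 1] by (simp add: one power2_eq_square)
  then show ?thesis
  proof
    assume "p 1 = 1"
    then interpret unital_C_star_seminorm st sc p
      using assms by unfold_locales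
    show ?thesis by (rule p_star_mult_le_sum)
  next
    assume zero: "p 1 = 0"
    have "p a \<le> p 1 * p a" "0 \<le> p a" for a
      using c_star_seminormD(1)[OF assms(2)] c_star_seminormD(4)[OF assms(2), of 1 a] by simp_all
    then have "p a = 0" for a
      using zero by (simp add: order_antisym)
    then show ?thesis by simp
  qed
qed

lemma hilbert_moduleD:
  assumes "hilbert_module st sc S act ip"
  shows "act (a + b) u = act a u + act b u"
    and "act 1 u = u"
    and "ip (u + v) w = ip u w + ip v w"
    and "ip (act a u) w = a * ip u w"
    and "st (ip u w) = ip w u"
    and "positive_elem st (ip u u)"
    and "ip u u = 0 \<Longrightarrow> u = 0"
  using assms by (simp_all only: hilbert_module_def)

lemma pro_C_star_algebraD:
  assumes "pro_C_star_algebra st sc S"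
  shows "star_algebra st sc" and "p \<in> S \<Longrightarrow> c_star_seminorm st sc p" and "sn_hausdorff S"
  using assms unfolding pro_C_star_algebra_def by metis+

lemma hilbert_module_ip_right:
  assumes "star_algebra st sc" "hilbert_module st sc S act ip"
  shows "ip w (u + v) = ip w u + ip w v" and "ip w (act a u) = ip w u * st a"
  using star_algebraD(7-9)[OF assms(1)] hilbert_moduleD(3-5)[OF assms(2)] by metis+

text \<open>Expand \<open>ip z z\<close> for \<open>z = y - t w x\<close> with
  \<open>w = ip y x\<close>. Its cross terms are \<open>- 2 t w (st w)\<close>, and \<open>b\<close>
  is chosen so that \<open>st b * b\<close> cancels them. Since \<open>ip z z\<close> has the form
  \<open>st v * v\<close>, the previous inequality bounds \<open>2 t W\<^sup>2\<close> by the
  remaining terms.\<close>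

lemma hilbert_module_Cauchy_Schwarz:
  assumes alg: "star_algebra st sc" and sn: "c_star_seminorm st sc p"
    and hm: "hilbert_module st sc S act ip"
  shows "(p (ip y x))\<^sup>2 \<le> 9 * p (ip x x) * p (ip y y)"
proof -
  note ip = hilbert_moduleD(3-5)[OF hm] hilbert_module_ip_right[OF alg hm]
  note st = star_algebraD(7-10)[OF alg]
  note sc = star_algebraD(1,4)[OF alg] star_algebraD(2,5,6)[OF alg, symmetric]
  note p = c_star_seminormD[OF sn]
  define W X Y where "W = p (ip y x)" and "X = p (ip x x)" and "Y = p (ip y y)"
  have nonneg: "0 \<le> W" "0 \<le> X" "0 \<le> Y" by (simp_all add: p W_def X_def Y_def)
  have main: "2 * t * W\<^sup>2 \<le> 3 * (t\<^sup>2 * W\<^sup>2 * X + Y)" if t: "0 < t" for t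
  proof -
    define w where "w = ip y x"
    define b where "b = sc (of_real (sqrt (2 * t))) (st w)"
    define z where "z = act (sc (of_real (- t)) w) x + y"
    have bb: "st b * b = sc (of_real (2 * t)) (w * st w)"
      using t by (simp add: b_def st sc of_real_mult[symmetric] del: of_real_mult)
    obtain v where v: "ip z z = st v * v"
      using hilbert_moduleD(6)[OF hm] unfolding positive_elem_def by blast
    have w': "ip x y = st w" by (simp add: w_def ip)
    have "st b * b + ip z z = sc (of_real (t\<^sup>2)) (w * (ip x x * st w)) + ip y y"
    proof -
      have "ip z z = sc (of_real (t\<^sup>2)) (w * (ip x x * st w)) + ip y y + sc (of_real (- (2 * t))) (w * st w)"
      proof -
        have "sc (of_real (- (2 * t))) a = sc (of_real (- t)) a + sc (of_real (- t)) a" for a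
          unfolding star_algebraD(3)[OF alg, symmetric] by simp
        then show ?thesis
          by (simp add: z_def ip st sc w' w_def[symmetric] power2_eq_square algebra_simps)
      qed
      moreover have "sc (of_real (2 * t)) a + sc (of_real (- (2 * t))) a = 0" for a
        unfolding star_algebraD(3)[OF alg, symmetric]
        using star_algebraD(3)[OF alg, of 0 0 a] by simp
      ultimately show ?thesis by (simp add: bb add.assoc add.left_commute)
    qed
    then have "p (st b * b) \<le> 3 * p (sc (of_real (t\<^sup>2)) (w * (ip x x * st w)) + ip y y)"
      using c_star_seminorm_star_mult_le_sum[OF alg sn, of b v] v by simp
    moreover have "p (st b * b) = 2 * t * W\<^sup>2"
      unfolding p(5) using t
      by (simp add: b_def p c_star_seminorm_st[OF alg sn] w_def W_def power_mult_distrib)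
    moreover have "p (sc (of_real (t\<^sup>2)) (w * (ip x x * st w)) + ip y y) \<le> t\<^sup>2 * W\<^sup>2 * X + Y"
    proof -
      have "p (w * (ip x x * st w)) \<le> W * (X * W)"
        using p(4)[of w "ip x x * st w"] mult_left_mono[OF p(4)[of "ip x x" "st w"] p(1)[of w]]
        by (simp add: c_star_seminorm_st[OF alg sn] w_def W_def X_def)
      then have "t\<^sup>2 * p (w * (ip x x * st w)) \<le> t\<^sup>2 * (W * (X * W))"
        by (intro mult_left_mono) simp_all
      then show ?thesis
        using p(2)[of "sc (of_real (t\<^sup>2)) (w * (ip x x * st w))" "ip y y"]
        unfolding p(3) norm_of_real Y_def by (simp add: power2_eq_square[of W] mult_ac)
    qed
    ultimately show ?thesis
      by (metis mult_left_mono order_trans zero_le_numeral)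
  qed
  have "W\<^sup>2 \<le> 9 * X * Y"
  proof (cases "X = 0")
    case True
    have "W\<^sup>2 \<le> 0"
    proof (rule ccontr)
      assume "\<not> W\<^sup>2 \<le> 0"
      then have pos: "0 < W\<^sup>2" by simp
      have "2 * ((3 * Y + 1) / W\<^sup>2) * W\<^sup>2 \<le> 3 * Y"
        \<comment> \<open>For \<open>X = 0\<close> the bound on \<open>2 t W\<^sup>2\<close> does
          not depend on \<open>t\<close>; this \<open>t\<close> is large enough to violate
          it.\<close>
        using main[of "(3 * Y + 1) / W\<^sup>2"] pos nonneg True by simp
      then show False using pos nonneg by simp
    qed
    then show ?thesis by (simp add: True)
  next
    case False
    then have X: "0 < X" using nonneg by simp
    \<comment> \<open>\<open>t = 1 / (3 X)\<close> maximises
      \<open>2 t - 3 t\<^sup>2 X\<close>.\<close>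
    have "2 * (1 / (3 * X)) * W\<^sup>2 \<le> 3 * ((1 / (3 * X))\<^sup>2 * W\<^sup>2 * X + Y)"
      using X by (intro main) simp
    also have "\<dots> = (1 / (3 * X)) * W\<^sup>2 + 3 * Y"
      using X by (simp add: field_simps power2_eq_square)
    finally have "(1 / (3 * X)) * W\<^sup>2 \<le> 3 * Y" by simp
    then show ?thesis using X by (simp add: field_simps)
  qed
  then show ?thesis by (simp add: W_def X_def Y_def)
qed

section \<open>Unconditional sums and the adjoint of the synthesis operator\<close>

lemma sn_has_sumD:
  assumes "sn_has_sum N f I s" "p \<in> N" "0 < \<epsilon>"
  shows "eventually (\<lambda>F. p (sum f F - s) < \<epsilon>) (finite_subsets_at_top I)"
  using assms unfolding sn_has_sum_def by blast

text \<open>Every finite set containing \<open>j\<close> has sum \<open>f j\<close>. The conclusion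
  stays at the level of \<open>p\<close>, so that it serves both the algebra and the module.\<close>

lemma sn_has_sum_finite_support:
  assumes sum: "sn_has_sum N f UNIV s" and supp: "\<And>i. i \<noteq> j \<Longrightarrow> f i = 0" and "p \<in> N"
  shows "p (f j - s) \<le> 0"
proof (rule field_le_epsilon)
  fix e :: real
  assume "0 < e"
  then have "eventually (\<lambda>F. p (sum f F - s) < e) (finite_subsets_at_top UNIV)"
    using sn_has_sumD[OF sum \<open>p \<in> N\<close>] by blast
  then obtain F0 where F0: "finite F0" "\<And>F. finite F \<Longrightarrow> F0 \<subseteq> F \<Longrightarrow> p (sum f F - s) < e"
    unfolding eventually_finite_subsets_at_top by auto
  have "sum f (insert j F0) = f j"
    using F0(1) by (simp add: sum.insert_remove supp sum.neutral)
  then show "p (f j - s) \<le> 0 + e"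
    using F0(2)[of "insert j F0"] F0(1) by (simp add: subset_insertI)
qed

lemma sn_has_sum_add:
  assumes tri: "\<And>p a b. p \<in> N \<Longrightarrow> p (a + b) \<le> p a + p b"
    and "sn_has_sum N f I s" "sn_has_sum N g I t"
  shows "sn_has_sum N (\<lambda>i. f i + g i) I (s + t)"
  unfolding sn_has_sum_def
proof (intro ballI allI impI)
  fix p and e :: real
  assume p: "p \<in> N" and e: "0 < e"
  have "eventually (\<lambda>F. p (sum f F - s) < e / 2 \<and> p (sum g F - t) < e / 2) (finite_subsets_at_top I)"
    using e by (intro eventually_conj sn_has_sumD[OF assms(2) p] sn_has_sumD[OF assms(3) p]) simp_all
  then show "eventually (\<lambda>F. p (sum (\<lambda>i. f i + g i) F - (s + t)) < e) (finite_subsets_at_top I)"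
  proof (rule eventually_mono)
    fix F
    assume F: "p (sum f F - s) < e / 2 \<and> p (sum g F - t) < e / 2"
    have "sum (\<lambda>i. f i + g i) F - (s + t) = (sum f F - s) + (sum g F - t)"
      by (simp add: sum.distrib)
    then show "p (sum (\<lambda>i. f i + g i) F - (s + t)) < e"
      using tri[OF p, of "sum f F - s" "sum g F - t"] F by (auto simp only:)
  qed
qed

text \<open>Test the adjoint relation on the basis sequence \<open>e\<close> at \<open>j\<close>:
  \<open>L\<close> sends it to \<open>\<eta>s j\<close>, and its pairing with \<open>Ls x\<close> is
  \<open>st (Ls x j)\<close>.\<close>

lemma HA_adjoint_synthesis_op:
  assumes pro: "pro_C_star_algebra st sc S" and hm: "hilbert_module st sc S act ip"
    and syn: "synthesis_op st S act ip \<eta>s L" and adj: "HA_adjoint st S ip L Ls"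
  shows "Ls x j = ip x (\<eta>s j)"
proof -
  note alg = pro_C_star_algebraD(1)[OF pro] and sn = pro_C_star_algebraD(2)[OF pro]
    and haus = pro_C_star_algebraD(3)[OF pro]
  have p0: "p 0 = 0" if "p \<in> S" for p
    using c_star_seminormD(3)[OF sn[OF that], of 0 0] star_algebraD(3)[OF alg, of 0 0 0] by simp
  have zeroI: "a = 0" if "\<And>p. p \<in> S \<Longrightarrow> p a \<le> 0" for a
    using haus that c_star_seminormD(1)[OF sn] unfolding sn_hausdorff_def by (metis order_antisym)
  note st = star_algebraD(7-9)[OF alg]
  have st1: "st 1 = 1" using st(3)[of "st 1" 1] st(1) by simp
  have act0: "act 0 u = 0" for u
    using hilbert_moduleD(1)[OF hm, of 0 0 u] by simp
  note act1 = hilbert_moduleD(2)[OF hm] and ip_zero = hilbert_moduleD(7)[OF hm]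
    and st_ip = hilbert_moduleD(5)[OF hm]
  define e where "e = (\<lambda>i. if i = j then 1 else (0::'a))"
  have e: "in_HA st S e"
    unfolding in_HA_def
  proof (intro exI[of _ 1])
    show "sn_has_sum S (\<lambda>i. e i * st (e i)) UNIV 1"
      unfolding sn_has_sum_def
    proof (intro ballI allI impI)
      fix p and \<epsilon> :: real
      assume p: "p \<in> S" and "0 < \<epsilon>"
      have "sum (\<lambda>i. e i * st (e i)) F = 1" if "finite F" "{j} \<subseteq> F" for F
      proof -
        have "sum (\<lambda>i. e i * st (e i)) F = sum (\<lambda>i. if i = j then 1 else 0) F"
          by (rule sum.cong) (simp_all add: e_def st1)
        then show ?thesis using that by simp
      qed
      then show "eventually (\<lambda>F. p (sum (\<lambda>i. e i * st (e i)) F - 1) < \<epsilon>) (finite_subsets_at_top UNIV)"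
        unfolding eventually_finite_subsets_at_top using p0[OF p] \<open>0 < \<epsilon>\<close>
        by (intro exI[of _ "{j}"]) auto
    qed
  qed
  have Le: "L e = \<eta>s j"
  proof -
    have sum: "sn_has_sum (mod_seminorms S ip) (\<lambda>i. act (e i) (\<eta>s i)) UNIV (L e)"
      using syn e unfolding synthesis_op_def by blast
    let ?d = "\<eta>s j - L e"
    have "p (ip ?d ?d) \<le> 0" if "p \<in> S" for p
      using sn_has_sum_finite_support[OF sum, of j "\<lambda>\<xi>. sqrt (p (ip \<xi> \<xi>))"] that
      by (simp add: e_def act0 act1 mod_seminorms_def)
    then show ?thesis using zeroI[of "ip ?d ?d"] ip_zero[of ?d] by simp
  qed
  have sum: "sn_has_sum S (\<lambda>i. e i * st (Ls x i)) UNIV (ip (L e) x)"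
    using adj e unfolding HA_adjoint_def by blast
  have "p (st (Ls x j) - ip (L e) x) \<le> 0" if "p \<in> S" for p
    using sn_has_sum_finite_support[OF sum, of j p] that by (simp add: e_def)
  then have "st (Ls x j) = ip (\<eta>s j) x"
    using zeroI[of "st (Ls x j) - ip (L e) x"] Le by simp
  then show ?thesis using st(1) st_ip by metis
qed

theorem theorem5p5:
  fixes st :: "'a::ring_1 \<Rightarrow> 'a" and sc :: "complex \<Rightarrow> 'a \<Rightarrow> 'a" and S :: "('a \<Rightarrow> real) set"
    and act :: "'a \<Rightarrow> 'x::ab_group_add \<Rightarrow> 'x" and ip :: "'x \<Rightarrow> 'x \<Rightarrow> 'a"
    and K Ks :: "'x \<Rightarrow> 'x"
    and \<xi>s \<eta>s :: "'i::countable \<Rightarrow> 'x"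
    and L1 L2 :: "('i \<Rightarrow> 'a) \<Rightarrow> 'x" and L2s :: "'x \<Rightarrow> 'i \<Rightarrow> 'a"
  assumes "pro_C_star_algebra st sc S"
    and "hilbert_module st sc S act ip"
    and "hom_star S act ip K"
    and "is_adjoint ip K Ks"
    and "parseval_K_frame S ip Ks \<xi>s"
    and "parseval_K_frame S ip Ks \<eta>s"
    and "synthesis_op st S act ip \<xi>s L1"
    and "synthesis_op st S act ip \<eta>s L2"
    and "HA_adjoint st S ip L2 L2s"
    and "\<forall>x. L1 (L2s x) = 0"
  shows "tight_K_frame sc S ip Ks 2 (\<lambda>i. \<xi>s i + \<eta>s i)"
  unfolding tight_K_frame_def
proof
  fix x
  note alg = pro_C_star_algebraD(1)[OF assms(1)] and sn = pro_C_star_algebraD(2)[OF assms(1)]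
  note ip = hilbert_moduleD(3-5)[OF assms(2)] hilbert_module_ip_right[OF alg assms(2)]
  note st = star_algebraD(7-9)[OF alg]
  have ip_sum: "ip (sum f F) x = (\<Sum>i\<in>F. ip (f i) x)" for f :: "'i \<Rightarrow> 'x" and F
  proof -
    interpret additive "\<lambda>u. ip u x" by unfold_locales (rule ip(1))
    show ?thesis by (rule sum)
  qed
  have st_sum: "st (sum f F) = (\<Sum>i\<in>F. st (f i))" for f :: "'i \<Rightarrow> 'a" and F
  proof -
    interpret additive st by unfold_locales (rule st(2))
    show ?thesis by (rule sum)
  qed
  \<comment> \<open>Thus \<open>L1 (L2s x)\<close> is the sum of the series with coefficients
    \<open>ip x (\<eta>s i)\<close> and vectors \<open>\<xi>s i\<close>, which therefore
    vanishes.\<close>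
  have L2s: "L2s x = (\<lambda>i. ip x (\<eta>s i))"
    using HA_adjoint_synthesis_op[OF assms(1,2,8,9)] by blast
  have zero_sum: "sn_has_sum (mod_seminorms S ip) (\<lambda>i. act (ip x (\<eta>s i)) (\<xi>s i)) UNIV 0"
    using assms(7,9,10) L2s unfolding synthesis_op_def HA_adjoint_def by metis
  have cross: "sn_has_sum S (\<lambda>i. ip x (\<eta>s i) * ip (\<xi>s i) x) UNIV 0"
    unfolding sn_has_sum_def
  proof (intro ballI allI impI)
    fix p and e :: real
    assume p: "p \<in> S" and e: "0 < e"
    note nonneg = c_star_seminormD(1)[OF sn[OF p]]
    \<comment> \<open>Cauchy-Schwarz makes \<open>ip d x\<close> Lipschitz in \<open>d\<close>; the
      summand 1 keeps \<open>C\<close> positive, so that \<open>e / C\<close> is a valid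
      tolerance.\<close>
    define C where "C = 3 * sqrt (p (ip x x)) + 1"
    have C: "0 < C" using nonneg by (simp add: C_def add_nonneg_pos)
    have bound: "p (ip d x) \<le> C * sqrt (p (ip d d))" for d
    proof -
      have "p (ip d x) \<le> sqrt (9 * p (ip x x) * p (ip d d))"
        using hilbert_module_Cauchy_Schwarz[OF alg sn[OF p] assms(2), of d x] by (rule real_le_rsqrt)
      also have "\<dots> = 3 * sqrt (p (ip x x)) * sqrt (p (ip d d))"
        by (simp add: real_sqrt_mult)
      also have "\<dots> \<le> C * sqrt (p (ip d d))"
        using nonneg by (intro mult_right_mono) (simp_all add: C_def)
      finally show ?thesis .
    qed
    have "(\<lambda>\<xi>. sqrt (p (ip \<xi> \<xi>))) \<in> mod_seminorms S ip"
      using p unfolding mod_seminorms_def by blast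
    then have "eventually (\<lambda>F. sqrt (p (ip ((\<Sum>i\<in>F. act (ip x (\<eta>s i)) (\<xi>s i)) - 0)
        ((\<Sum>i\<in>F. act (ip x (\<eta>s i)) (\<xi>s i)) - 0))) < e / C) (finite_subsets_at_top UNIV)"
      by (rule sn_has_sumD[OF zero_sum]) (use e C in simp)
    then show "eventually (\<lambda>F. p ((\<Sum>i\<in>F. ip x (\<eta>s i) * ip (\<xi>s i) x) - 0) < e)
        (finite_subsets_at_top UNIV)"
    proof (rule eventually_mono)
      fix F
      let ?d = "\<Sum>i\<in>F. act (ip x (\<eta>s i)) (\<xi>s i)"
      assume "sqrt (p (ip (?d - 0) (?d - 0))) < e / C"
      then have "C * sqrt (p (ip ?d ?d)) < e" using C by (simp add: field_simps)
      then show "p ((\<Sum>i\<in>F. ip x (\<eta>s i) * ip (\<xi>s i) x) - 0) < e"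
        using bound[of ?d] by (simp add: ip_sum ip)
    qed
  qed
  have cross': "sn_has_sum S (\<lambda>i. ip x (\<xi>s i) * ip (\<eta>s i) x) UNIV 0"
    unfolding sn_has_sum_def
  proof (intro ballI allI impI)
    fix p and e :: real
    assume p: "p \<in> S" and e: "0 < e"
    \<comment> \<open>The partial sums of the two cross series are adjoint to each other, and
      \<open>p\<close> is invariant under \<open>st\<close>.\<close>
    have "p (\<Sum>i\<in>F. ip x (\<xi>s i) * ip (\<eta>s i) x) = p (\<Sum>i\<in>F. ip x (\<eta>s i) * ip (\<xi>s i) x)" for F
      using c_star_seminorm_st[OF alg sn[OF p], of "\<Sum>i\<in>F. ip x (\<eta>s i) * ip (\<xi>s i) x"]
      by (simp add: st_sum st ip)
    then show "eventually (\<lambda>F. p ((\<Sum>i\<in>F. ip x (\<xi>s i) * ip (\<eta>s i) x) - 0) < e)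
        (finite_subsets_at_top UNIV)"
      using sn_has_sumD[OF cross p e] by simp
  qed
  have diag: "sn_has_sum S (\<lambda>i. ip x (\<xi>s i) * ip (\<xi>s i) x) UNIV (ip (Ks x) (Ks x))"
    "sn_has_sum S (\<lambda>i. ip x (\<eta>s i) * ip (\<eta>s i) x) UNIV (ip (Ks x) (Ks x))"
    using assms(5,6) unfolding parseval_K_frame_def by blast+
  have "sn_has_sum S (\<lambda>i. (ip x (\<xi>s i) * ip (\<xi>s i) x + ip x (\<eta>s i) * ip (\<eta>s i) x)
      + (ip x (\<eta>s i) * ip (\<xi>s i) x + ip x (\<xi>s i) * ip (\<eta>s i) x)) UNIV
      ((ip (Ks x) (Ks x) + ip (Ks x) (Ks x)) + (0 + 0))"
    by (intro sn_has_sum_add c_star_seminormD(2)[OF sn] diag cross cross')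
  moreover have "(ip (Ks x) (Ks x) + ip (Ks x) (Ks x)) + (0 + 0) = sc (complex_of_real 2) (ip (Ks x) (Ks x))"
    using star_algebraD(3)[OF alg, of 1 1 "ip (Ks x) (Ks x)"] star_algebraD(1)[OF alg] by simp
  ultimately show "sn_has_sum S (\<lambda>i. ip x (\<xi>s i + \<eta>s i) * ip (\<xi>s i + \<eta>s i) x) UNIV
      (sc (complex_of_real 2) (ip (Ks x) (Ks x)))"
    by (simp add: ip algebra_simps)
qed

end
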